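(* The competitive equilibrium in the two-stage market with a real-time MPM policy exists and is given by \begin{align*} &g_j^d+g_j^r=\frac{c_j^{-1}}{\sum_{k\in\mathcal{G}}c_k^{-1}}\,d,\qquad \beta_j^d\in\mathbb{R},\quad\forall j\in\mathcal{G},\\ &d_l^d+d_l^r=d_l,\quad\forall l\in\mathcal{L},\\ &\lambda^d=\lambda^r=\frac{d}{\sum_{k\in\mathcal{G}}c_k^{-1}} \end{align*} (where, as part of the definition of an equilibrium, the bids and allocations also satisfy day-ahead market clearing).
   Context: Market: $\mathcal{G}$ (generators) and $\mathcal{L}$ (loads) are finite nonempty sets. Generator $j$ has cost $\frac{c_j}{2}g_j^2$, $c_j>0$, for total dispatch $g_j=g_j^d+g_j^r$ (day-ahead plus real-time dispatch, real numbers). Load $l$ has fixed inelastic demand $d_l>0$ split as $d_l=d_l^d+d_l^r$ with $d_l^d,d_l^r\in\mathbb{R}$; $d:=\sum_l d_l$. Supply-demand balance over the two stages: $\sum_jg_j=d$. Day-ahead market: with fixed slope $b^d>0$, generator $j$ bids $\beta_j^d\in\mathbb{R}$, meaning $g_j^d=b^d\lambda^d-\beta_j^d$; load $l$ bids $d_l^d$; the market clears when $\sum_j(b^d\lambda^d-\beta_j^d)=\sum_ld_l^d$. Real-time MPM (market power mitigation) policy: in real time, generator bids are replaced by true costs, so $g_j^r=c_j^{-1}\lambda^r-g_j^d$ for all $j$, and by power balance $\lambda^r=d/\sum_{k\in\mathcal{G}}c_k^{-1}$. Profit of generator $j$: $\pi_j=\lambda^rg_j^r+\lambda^dg_j^d-\frac{c_j}{2}(g_j^d+g_j^r)^2$.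 Payment of load $l$: $\rho_l=\lambda^dd_l^d+\lambda^r(d_l-d_l^d)$. With the policy substituted, price-taking generator $j$ solves, given $\lambda^d$, $\max_{\beta_j^d\in\mathbb{R}}\left(\frac{d}{\sum_kc_k^{-1}}-\lambda^d\right)\beta_j^d$, and price-taking load $l$ solves, given $\lambda^d$, $\min_{d_l^d\in\mathbb{R}}\left(\lambda^d-\frac{d}{\sum_kc_k^{-1}}\right)d_l^d$ (up to additive constants). Competitive equilibrium: bids, allocations ($d_l^r=d_l-d_l^d$) and prices such that, with $\lambda^d$ taken as given, each $\beta_j^d$ and each $d_l^d$ solves its individual problem, the day-ahead market clears, and the real-time dispatch and price are given by the policy rule. *)

theory Defs
  imports Complex_Main
begin

record ('g, 'l) market_outcome =
  bid :: "'g \<Rightarrow> real"            \<comment> \<open>\<open>\<beta>\<^sup>d\<close>\<close>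
  gen_da :: "'g \<Rightarrow> real"         \<comment> \<open>\<open>g\<^sup>d\<close>\<close>
  gen_rt :: "'g \<Rightarrow> real"         \<comment> \<open>\<open>g\<^sup>r\<close>\<close>
  load_da :: "'l \<Rightarrow> real"        \<comment> \<open>\<open>d\<^sup>d\<close>, which is also the bid of a load\<close>
  load_rt :: "'l \<Rightarrow> real"        \<comment> \<open>\<open>d\<^sup>r\<close>\<close>
  price_da :: real               \<comment> \<open>\<open>\<lambda>\<^sup>d\<close>\<close>
  price_rt :: real               \<comment> \<open>\<open>\<lambda>\<^sup>r\<close>\<close>

definition profit :: "real \<Rightarrow> real \<Rightarrow> real \<Rightarrow> real \<Rightarrow> real \<Rightarrow> real" where
  "profit cj ld lr gd gr = lr * gr + ld * gd - cj / 2 * (gd + gr)\<^sup>2"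

definition payment :: "real \<Rightarrow> real \<Rightarrow> real \<Rightarrow> real \<Rightarrow> real" where
  "payment dem ld lr dd = ld * dd + lr * (dem - dd)"

definition bid_dispatch :: "real \<Rightarrow> real \<Rightarrow> real \<Rightarrow> real" where
  "bid_dispatch b ld \<beta> = b * ld - \<beta>"

definition mpm_dispatch :: "real \<Rightarrow> real \<Rightarrow> real \<Rightarrow> real" where
  "mpm_dispatch cj lr gd = inverse cj * lr - gd"

definition mpm_price :: "'g set \<Rightarrow> 'l set \<Rightarrow> ('g \<Rightarrow> real) \<Rightarrow> ('l \<Rightarrow> real) \<Rightarrow> real" where
  "mpm_price G L c dem = (\<Sum>l\<in>L. dem l) / (\<Sum>k\<in>G. inverse (c k))"

text \<open>
  The rule for the real-time price is exactly what supply-demand balance over the two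
  stages forces on the real-time dispatch.
\<close>

lemma mpm_price_iff_balance:
  assumes "(\<Sum>k\<in>G. inverse (c k)) \<noteq> 0"
  shows "(\<Sum>j\<in>G. gd j + mpm_dispatch (c j) lr (gd j)) = (\<Sum>l\<in>L. dem l)
         \<longleftrightarrow> lr = mpm_price G L c dem"
proof -
  have "(\<Sum>j\<in>G. gd j + mpm_dispatch (c j) lr (gd j)) = lr * (\<Sum>k\<in>G. inverse (c k))"
    by (simp add: mpm_dispatch_def sum_distrib_left mult.commute)
  then show ?thesis
    using assms by (simp add: mpm_price_def eq_divide_eq)
qed

text \<open>
  In the individual problems the day-ahead price \<open>ld\<close> is taken as given, while the real-time
  dispatch and price are those prescribed by the policy.
\<close>

definition gen_objective ::
  "'g set \<Rightarrow> 'l set \<Rightarrow> ('g \<Rightarrow> real) \<Rightarrow> ('l \<Rightarrow> real) \<Rightarrow> real \<Rightarrow> real \<Rightarrow> 'g \<Rightarrow> real \<Rightarrow> real" where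
  "gen_objective G L c dem b ld j \<beta> =
     (let lr = mpm_price G L c dem; gd = bid_dispatch b ld \<beta>
      in profit (c j) ld lr gd (mpm_dispatch (c j) lr gd))"

definition load_objective ::
  "'g set \<Rightarrow> 'l set \<Rightarrow> ('g \<Rightarrow> real) \<Rightarrow> ('l \<Rightarrow> real) \<Rightarrow> real \<Rightarrow> 'l \<Rightarrow> real \<Rightarrow> real" where
  "load_objective G L c dem ld l dd = payment (dem l) ld (mpm_price G L c dem) dd"

text \<open>Up to additive constants both objectives are linear in the decision variable.\<close>

lemma gen_objective_linear:
  "gen_objective G L c dem b ld j \<beta> =
     (mpm_price G L c dem - ld) * \<beta> + gen_objective G L c dem b ld j 0"
  by (simp add: gen_objective_def Let_def profit_def bid_dispatch_def mpm_dispatch_def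
      algebra_simps)

lemma load_objective_linear:
  "load_objective G L c dem ld l dd =
     (ld - mpm_price G L c dem) * dd + load_objective G L c dem ld l 0"
  by (simp add: load_objective_def payment_def algebra_simps)

definition day_ahead_clearing ::
  "'g set \<Rightarrow> 'l set \<Rightarrow> real \<Rightarrow> ('g, 'l) market_outcome \<Rightarrow> bool" where
  "day_ahead_clearing G L b m \<longleftrightarrow>
     (\<forall>j\<in>G. gen_da m j = bid_dispatch b (price_da m) (bid m j)) \<and>
     (\<Sum>j\<in>G. bid_dispatch b (price_da m) (bid m j)) = (\<Sum>l\<in>L. load_da m l)"

definition competitive_equilibrium ::
  "'g set \<Rightarrow> 'l set \<Rightarrow> ('g \<Rightarrow> real) \<Rightarrow> ('l \<Rightarrow> real) \<Rightarrow> real \<Rightarrow> ('g, 'l) market_outcome \<Rightarrow> bool"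
where
  "competitive_equilibrium G L c dem b m \<longleftrightarrow>
     (\<forall>j\<in>G. is_arg_max (gen_objective G L c dem b (price_da m) j) (\<lambda>_. True) (bid m j)) \<and>
     (\<forall>l\<in>L. is_arg_min (load_objective G L c dem (price_da m) l) (\<lambda>_. True) (load_da m l)) \<and>
     day_ahead_clearing G L b m \<and>
     (\<forall>l\<in>L. load_rt m l = dem l - load_da m l) \<and>
     (\<forall>j\<in>G. gen_rt m j = mpm_dispatch (c j) (price_rt m) (gen_da m j)) \<and>
     price_rt m = mpm_price G L c dem"

end

theory Submission
  imports Defs
begin

text \<open>
  With the policy substituted, every participant optimises a linear function whose slope is, up to
  sign, \<open>\<lambda>\<^sup>d - \<lambda>\<^sup>r\<close>. On an unbounded domain such a function has an optimum only if the slope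
  vanishes, and then every bid is optimal. Hence the two prices agree, and the only
  remaining restriction on the bids is that the day-ahead market clears.
\<close>

text \<open>Moving from \<open>x\<close> by the slope \<open>a\<close> itself changes the value by
  \<open>a * a\<close>, so optimality at \<open>x\<close> forces
  \<open>a * a \<le> 0\<close>.\<close>

lemma is_arg_max_affine_iff:
  fixes f :: "real \<Rightarrow> real"
  assumes "\<And>x. f x = a * x + e"
  shows "is_arg_max f (\<lambda>_. True) x \<longleftrightarrow> a = 0"
proof
  assume "is_arg_max f (\<lambda>_. True) x"
  then have "\<not> a * (x + a) > a * x"
    by (simp add: is_arg_max_def assms)
  then have "a * a \<le> 0"
    by (simp add: algebra_simps)
  then show "a = 0"
    by (metis mult_eq_0_iff order_antisym zero_le_square)
qed (simp add: is_arg_max_def assms)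

lemma is_arg_min_affine_iff:
  fixes f :: "real \<Rightarrow> real"
  assumes "\<And>x. f x = a * x + e"
  shows "is_arg_min f (\<lambda>_. True) x \<longleftrightarrow> a = 0"
  using is_arg_max_affine_iff[of "\<lambda>x. - f x" "- a" "- e" x] assms
  by (simp add: is_arg_min_def is_arg_max_def)

lemma gen_optimal_iff:
  "is_arg_max (gen_objective G L c dem b ld j) (\<lambda>_. True) \<beta> \<longleftrightarrow> ld = mpm_price G L c dem"
  by (subst is_arg_max_affine_iff[OF gen_objective_linear]) auto

lemma load_optimal_iff:
  "is_arg_min (load_objective G L c dem ld l) (\<lambda>_. True) dd \<longleftrightarrow> ld = mpm_price G L c dem"
  by (subst is_arg_min_affine_iff[OF load_objective_linear]) auto

text \<open>The optimality conditions no longer mention the bids; since \<open>G\<close> is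
  nonempty, they yield the single equation between the two prices.\<close>

lemma competitive_equilibrium_iff:
  assumes "G \<noteq> {}"
  shows "competitive_equilibrium G L c dem b m \<longleftrightarrow>
    (\<forall>j\<in>G. gen_da m j + gen_rt m j
       = inverse (c j) / (\<Sum>k\<in>G. inverse (c k)) * (\<Sum>l\<in>L. dem l)) \<and>
    (\<forall>l\<in>L. load_da m l + load_rt m l = dem l) \<and>
    price_da m = price_rt m \<and>
    price_rt m = (\<Sum>l\<in>L. dem l) / (\<Sum>k\<in>G. inverse (c k)) \<and>
    day_ahead_clearing G L b m"
proof -
  \<comment> \<open>The policy subtracts the day-ahead dispatch, so it fixes only the total
    dispatch, at \<open>inverse (c j)\<close> times the real-time price.\<close>
  have "gen_rt m j = mpm_dispatch (c j) (mpm_price G L c dem) (gen_da m j) \<longleftrightarrow>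
      gen_da m j + gen_rt m j
        = inverse (c j) / (\<Sum>k\<in>G. inverse (c k)) * (\<Sum>l\<in>L. dem l)" for j
    by (auto simp: mpm_dispatch_def mpm_price_def)
  moreover have "load_rt m l = dem l - load_da m l \<longleftrightarrow> load_da m l + load_rt m l = dem l" for l
    by auto
  ultimately show ?thesis
    using assms
    unfolding competitive_equilibrium_def gen_optimal_iff load_optimal_iff
      mpm_price_def[symmetric]
    by auto
qed

lemma competitive_equilibrium_exists:
  fixes G :: "'g set" and L :: "'l set"
  assumes "finite L" "L \<noteq> {}"
  shows "\<exists>m :: ('g, 'l) market_outcome. competitive_equilibrium G L c dem b m"
proof -
  define p where "p = mpm_price G L c dem"
  \<comment> \<open>With all generator bids zero, each generator is dispatched \<open>b * p\<close>
    day-ahead; \<open>s\<close> is the equal share of this total per load.\<close>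
  define s where "s = real (card G) * (b * p) / real (card L)"
  define m :: "('g, 'l) market_outcome" where
    "m = \<lparr>bid = \<lambda>_. 0, gen_da = \<lambda>_. b * p, gen_rt = \<lambda>j. mpm_dispatch (c j) p (b * p),
          load_da = \<lambda>_. s, load_rt = \<lambda>l. dem l - s, price_da = p, price_rt = p\<rparr>"
  \<comment> \<open>This is day-ahead clearing for the witness; the division in \<open>s\<close>
    cancels because \<open>L\<close> is finite and nonempty.\<close>
  have "real (card L) * s = real (card G) * (b * p)"
    using assms by (simp add: s_def)
  then have "competitive_equilibrium G L c dem b m"
    unfolding competitive_equilibrium_def gen_optimal_iff load_optimal_iff day_ahead_clearing_def
    by (simp add: m_def bid_dispatch_def flip: p_def)
  then show ?thesis ..
qed

theorem theorem4:
  fixes G :: "'g set" and L :: "'l set"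
    and c :: "'g \<Rightarrow> real" and dem :: "'l \<Rightarrow> real" and b :: real
  assumes "finite G" and "G \<noteq> {}" and "finite L" and "L \<noteq> {}"
    and "\<forall>j\<in>G. c j > 0" and "\<forall>l\<in>L. dem l > 0" and "b > 0"
  shows "(\<exists>m :: ('g, 'l) market_outcome. competitive_equilibrium G L c dem b m) \<and>
    (\<forall>m :: ('g, 'l) market_outcome. competitive_equilibrium G L c dem b m \<longleftrightarrow>
       (\<forall>j\<in>G. gen_da m j + gen_rt m j
          = inverse (c j) / (\<Sum>k\<in>G. inverse (c k)) * (\<Sum>l\<in>L. dem l)) \<and>
       (\<forall>l\<in>L. load_da m l + load_rt m l = dem l) \<and>
       price_da m = price_rt m \<and>
       price_rt m = (\<Sum>l\<in>L. dem l) / (\<Sum>k\<in>G. inverse (c k)) \<and>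
       day_ahead_clearing G L b m)"
  using competitive_equilibrium_exists[OF assms(3,4)] competitive_equilibrium_iff[OF assms(2)]
  by blast

end
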